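(* Suppose $R(\mathbf{p},\mathbf{u})$ is convex in $\mathbf{u}$ for any $\mathbf{p}\in\mathcal{P}$, that $\mathcal{U}$ is a non-empty convex compact subset of $\mathbb{R}^M$, and that $\mathcal{P}$ is a finite set. Then there exists an optimal solution $\boldsymbol{\pi}^*$ to the problem $$\max_{\boldsymbol{\pi}\in\Delta_{\mathcal{P}}} \min_{\mathbf{u}\in\mathcal{U}} \sum_{\mathbf{p}\in\mathcal{P}} \pi_{\mathbf{p}} R(\mathbf{p},\mathbf{u})$$ such that $\boldsymbol{\pi}^*$ has a support of size at most $M+1$, i.e., the number of price vectors $\mathbf{p}\in\mathcal{P}$ for which $\pi^*_{\mathbf{p}}>0$ is at most $M+1$.
   Context: $\mathcal{P}\subseteq\mathbb{R}_+^I$ is a (nonempty) finite set of price vectors, $R:\mathcal{P}\times\mathcal{U}\to\mathbb{R}$ is the revenue function, and $\Delta_{\mathcal{P}} = \{\boldsymbol{\pi}\in\mathbb{R}^{\mathcal{P}} : \sum_{\mathbf{p}\in\mathcal{P}}\pi_{\mathbf{p}}=1,\ \pi_{\mathbf{p}}\ge 0\ \forall \mathbf{p}\in\mathcal{P}\}$ is the unit simplex. *)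

theory Defs
  imports "HOL-Analysis.Analysis"
begin

definition price_simplex :: "'p set \<Rightarrow> ('p \<Rightarrow> real) set" where
  "price_simplex P = {\<pi> \<in> P \<rightarrow>\<^sub>E UNIV. (\<Sum>p\<in>P. \<pi> p) = 1 \<and> (\<forall>p\<in>P. 0 \<le> \<pi> p)}"

definition expected_revenue :: "'p set \<Rightarrow> ('p \<Rightarrow> 'u \<Rightarrow> real) \<Rightarrow> ('p \<Rightarrow> real) \<Rightarrow> 'u \<Rightarrow> real" where
  "expected_revenue P R \<pi> u = (\<Sum>p\<in>P. \<pi> p * R p u)"

text \<open>
  A finite convex function on a compact convex set may jump at the relative boundary, so that the
  inner minimum need not be attained; the inner ``min'' is therefore an infimum. It is taken in
  the extended reals, where it exists without any boundedness condition. Whenever the minimum is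
  attained, it is equal to this infimum (lemma \<open>worst_case_revenue_eq_min\<close>).
\<close>

definition worst_case_revenue ::
    "'p set \<Rightarrow> 'u set \<Rightarrow> ('p \<Rightarrow> 'u \<Rightarrow> real) \<Rightarrow> ('p \<Rightarrow> real) \<Rightarrow> ereal" where
  "worst_case_revenue P U R \<pi> = (INF u\<in>U. ereal (expected_revenue P R \<pi> u))"

lemma worst_case_revenue_eq_min:
  assumes "u \<in> U" "\<And>v. v \<in> U \<Longrightarrow> expected_revenue P R \<pi> u \<le> expected_revenue P R \<pi> v"
  shows "worst_case_revenue P U R \<pi> = ereal (expected_revenue P R \<pi> u)"
  unfolding worst_case_revenue_def
  by (rule antisym) (auto intro!: INF_lower INF_greatest assms)

definition optimal_randomized_pricing ::
    "'p set \<Rightarrow> 'u set \<Rightarrow> ('p \<Rightarrow> 'u \<Rightarrow> real) \<Rightarrow> ('p \<Rightarrow> real) \<Rightarrow> bool" where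
  "optimal_randomized_pricing P U R \<pi> \<longleftrightarrow>
     \<pi> \<in> price_simplex P \<and>
     (\<forall>\<rho>\<in>price_simplex P. worst_case_revenue P U R \<rho> \<le> worst_case_revenue P U R \<pi>)"

end

theory Submission imports Defs begin

text \<open>
  Let \<open>v\<close> be the infimum over \<open>u\<close> of the maximum over \<open>p\<close> of \<open>R p u\<close>, an upper bound for every
  worst-case revenue. The convex sets \<open>{u \<in> U. R p u < v}\<close> have empty intersection, so by Helly's
  theorem at most \<open>M + 1\<close> of them already do. Separating \<open>0\<close> from the points that strictly dominate
  the vectors \<open>R p u - v\<close>, for these \<open>M + 1\<close> prices only, gives weights whose worst-case revenue is
  at least \<open>v\<close>.
\<close>

lemma convex_on_imp_convex_strict_sublevel:
  assumes "convex_on U f"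
  shows "convex {u \<in> U. f u < (c::real)}"
proof (rule convexI)
  fix x y and s t :: real
  assume x: "x \<in> {u \<in> U. f u < c}" and y: "y \<in> {u \<in> U. f u < c}"
    and st: "0 \<le> s" "0 \<le> t" "s + t = 1"
  have "s *\<^sub>R x + t *\<^sub>R y \<in> U"
    using convex_on_imp_convex[OF assms] x y st by (auto simp: convex_def)
  moreover have "f (s *\<^sub>R x + t *\<^sub>R y) \<le> s * f x + t * f y"
    using assms x y st by (auto simp: convex_on_def)
  moreover have "s * f x + t * f y < c"
    using convex_bound_lt[of "f x" c "f y" s t] x y st by simp
  ultimately show "s *\<^sub>R x + t *\<^sub>R y \<in> {u \<in> U. f u < c}"
    by simp
qed

text \<open>\<open>Helly\<close> speaks of a set of sets, in which equal members \<open>C p\<close>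
  coincide. Choosing indices on which \<open>C\<close> is injective carries the bound on the number
  of sets over to the number of indices. If there are too few sets for \<open>Helly\<close>, all of
  them are kept.\<close>

lemma helly_indexed:
  fixes C :: "'p \<Rightarrow> 'a::euclidean_space set"
  assumes "finite P" and "\<And>p. p \<in> P \<Longrightarrow> convex (C p)" and "\<Inter>(C ` P) = {}"
  obtains S where "S \<subseteq> P" "card S \<le> DIM('a) + 1" "\<Inter>(C ` S) = {}"
proof -
  obtain T where T: "T \<subseteq> C ` P" "card T \<le> DIM('a) + 1" "\<Inter>T = {}"
  proof (cases "DIM('a) + 1 \<le> card (C ` P)")
    case True
    have "\<forall>A\<in>C ` P. convex A"
      using assms(2) by blast
    then obtain T where "T \<subseteq> C ` P" "card T = DIM('a) + 1" "\<Inter>T = {}"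
      using Helly[OF True] assms(3) by blast
    then show ?thesis
      using that[of T] by simp
  next
    case False
    then show ?thesis
      using that[of "C ` P"] assms(3) by simp
  qed
  obtain S where "S \<subseteq> P" "inj_on C S" "T = C ` S"
    using T(1) by (auto simp: subset_image_inj)
  then show ?thesis
    using that T by (simp add: card_image)
qed

lemma ex_fun_range_eq:
  fixes S :: "'a set"
  assumes "finite S" "S \<noteq> {}" "card S \<le> CARD('j)"
  obtains h :: "'j \<Rightarrow> 'a" where "range h = S"
proof -
  have "0 < CARD('j)"
    using assms card_gt_0_iff[of S] by linarith
  then have "finite (UNIV :: 'j set)"
    by (rule card_ge_0_finite)
  then obtain g :: "'a \<Rightarrow> 'j" where g: "inj_on g S"
    using card_le_inj[of S "UNIV :: 'j set"] assms by auto
  obtain a where a: "a \<in> S"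
    using assms by blast
  \<comment> \<open>The inverse of the injection \<open>g\<close> already reaches all of
    \<open>S\<close>; the surplus indices are sent to the arbitrary element
    \<open>a\<close>.\<close>
  have "range (\<lambda>j. if j \<in> g ` S then inv_into S g j else a) = S"
  proof (intro subset_antisym subsetI)
    fix x assume "x \<in> S"
    then show "x \<in> range (\<lambda>j. if j \<in> g ` S then inv_into S g j else a)"
      using g by (intro range_eqI[of _ _ "g x"]) simp
  qed (use a in \<open>auto simp: inv_into_into split: if_splits\<close>)
  then show ?thesis
    using that by blast
qed

text \<open>A convex form of Gordan's alternative: if the inequalities \<open>f j u < v\<close> have
  no common solution, the normal of a separating hyperplane, scaled to total mass 1, provides the
  weights.\<close>

lemma convex_on_weights_of_alternative:
  fixes f :: "'j::finite \<Rightarrow> 'a::real_vector \<Rightarrow> real"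
  assumes "U \<noteq> {}" and "convex U" and f: "\<And>j. convex_on U (f j)"
    and alt: "\<And>u. u \<in> U \<Longrightarrow> \<exists>j. v \<le> f j u"
  obtains a :: "'j \<Rightarrow> real" where "\<And>j. 0 \<le> a j" "(\<Sum>j\<in>UNIV. a j) = 1"
    "\<And>u. u \<in> U \<Longrightarrow> v \<le> (\<Sum>j\<in>UNIV. a j * f j u)"
proof -
  define K where "K = {y :: real ^ 'j. \<exists>u\<in>U. \<forall>j. f j u - v < y $ j}"
  have "convex K"
  proof (rule convexI)
    fix x y and s t :: real
    assume "x \<in> K" "y \<in> K" and st: "0 \<le> s" "0 \<le> t" "s + t = 1"
    then obtain u w where u: "u \<in> U" "\<And>j. f j u - v < x $ j"
      and w: "w \<in> U" "\<And>j. f j w - v < y $ j"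
      unfolding K_def by blast
    have "f j (s *\<^sub>R u + t *\<^sub>R w) - v < (s *\<^sub>R x + t *\<^sub>R y) $ j" for j
    proof -
      have "f j (s *\<^sub>R u + t *\<^sub>R w) \<le> s * f j u + t * f j w"
        using f[of j] u w st by (auto simp: convex_on_def)
      moreover have "s * (f j u - v - x $ j) + t * (f j w - v - y $ j) < 0"
        using u(2)[of j] w(2)[of j] st by (intro convex_bound_lt) auto
      moreover have "s * v + t * v = v"
        using st by (metis distrib_right mult_1)
      ultimately show ?thesis
        by (simp add: algebra_simps)
    qed
    moreover have "s *\<^sub>R u + t *\<^sub>R w \<in> U"
      using \<open>convex U\<close> u w st by (auto simp: convex_def)
    ultimately show "s *\<^sub>R x + t *\<^sub>R y \<in> K"
      unfolding K_def by blast
  qed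
  moreover have "0 \<notin> K"
  proof
    assume "0 \<in> K"
    then obtain u where "u \<in> U" "\<And>j. f j u < v"
      by (auto simp: K_def)
    then show False
      using alt by (meson not_less)
  qed
  ultimately obtain a where a: "a \<noteq> 0" "\<And>y. y \<in> K \<Longrightarrow> 0 \<le> a \<bullet> y"
    using separating_hyperplane_set_0 by blast
  \<comment> \<open>\<open>K\<close> is closed under increasing a coordinate. If
    \<open>a $ j\<close> were negative, going far enough along axis \<open>j\<close> would make the
    inner product negative; the \<open>t\<close> below brings it to at most -1.\<close>
  have nonneg: "0 \<le> a $ j" for j
  proof (rule ccontr)
    assume neg: "\<not> 0 \<le> a $ j"
    obtain u where u: "u \<in> U"
      using \<open>U \<noteq> {}\<close> by blast
    define y where "y = (\<chi> j. f j u - v + 1)"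
    define t where "t = (\<bar>a \<bullet> y\<bar> + 1) / - (a $ j)"
    have t: "0 \<le> t" "t * a $ j = - (\<bar>a \<bullet> y\<bar> + 1)"
      using neg by (auto simp: t_def divide_simps)
    have "y + t *\<^sub>R axis j 1 \<in> K"
      using u t(1) unfolding K_def y_def
      by (auto intro!: bexI[of _ u] simp: axis_def)
    then have "0 \<le> a \<bullet> y + t * a $ j"
      using a(2) by (fastforce simp: inner_add_right inner_axis)
    then show False
      using t(2) by linarith
  qed
  define A where "A = (\<Sum>j\<in>UNIV. a $ j)"
  have "0 < A"
  proof -
    obtain j where "a $ j \<noteq> 0"
      using a(1) by (auto simp: vec_eq_iff)
    then show ?thesis
      unfolding A_def using nonneg by (intro sum_pos2[of _ j]) (auto simp: less_le)
  qed
  \<comment> \<open>The vector of the values \<open>f j u - v\<close> need not lie in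
    \<open>K\<close>, where domination is strict. Raising every coordinate by \<open>e / A\<close>
    puts it there and adds exactly \<open>e\<close> to the inner product.\<close>
  have ge: "v * A \<le> (\<Sum>j\<in>UNIV. a $ j * f j u)" if "u \<in> U" for u
  proof (rule field_le_epsilon)
    fix e :: real assume "0 < e"
    have "(\<chi> j. f j u - v + e / A) \<in> K"
      using that \<open>0 < e\<close> \<open>0 < A\<close> by (auto simp: K_def intro!: bexI[of _ u])
    then have "0 \<le> a \<bullet> (\<chi> j. f j u - v + e / A)"
      by (rule a(2))
    also have "\<dots> = (\<Sum>j\<in>UNIV. a $ j * f j u) - A * v + A * (e / A)"
      by (simp add: inner_vec_def A_def algebra_simps sum.distrib sum_subtractf
          sum_distrib_left sum_distrib_right sum_divide_distrib)
    finally show "v * A \<le> (\<Sum>j\<in>UNIV. a $ j * f j u) + e"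
      using \<open>0 < A\<close> by (simp add: mult.commute)
  qed
  show ?thesis
  proof (rule that[of "\<lambda>j. a $ j / A"])
    show "0 \<le> a $ j / A" for j
      using nonneg \<open>0 < A\<close> by simp
    show "(\<Sum>j\<in>UNIV. a $ j / A) = 1"
      using \<open>0 < A\<close> by (simp add: A_def flip: sum_divide_distrib)
    show "v \<le> (\<Sum>j\<in>UNIV. a $ j / A * f j u)" if "u \<in> U" for u
      using ge[OF that] \<open>0 < A\<close> by (simp add: pos_le_divide_eq flip: sum_divide_distrib)
  qed
qed

lemma expected_revenue_le_Max:
  assumes "finite P" "P \<noteq> {}" "\<rho> \<in> price_simplex P"
  shows "expected_revenue P R \<rho> u \<le> Max ((\<lambda>p. R p u) ` P)"
proof -
  have "expected_revenue P R \<rho> u \<le> (\<Sum>p\<in>P. \<rho> p * Max ((\<lambda>p. R p u) ` P))"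
    unfolding expected_revenue_def using assms
    by (intro sum_mono mult_left_mono) (auto simp: price_simplex_def)
  also have "\<dots> = Max ((\<lambda>p. R p u) ` P)"
    using assms by (simp add: price_simplex_def flip: sum_distrib_right)
  finally show ?thesis .
qed

text \<open>Weak duality, by averaging at each \<open>u\<close>: a pricing whose worst case reaches
  this bound is optimal.\<close>

lemma worst_case_revenue_le_minimax:
  assumes "finite P" "P \<noteq> {}" "\<rho> \<in> price_simplex P"
  shows "worst_case_revenue P U R \<rho> \<le> (INF u\<in>U. ereal (Max ((\<lambda>p. R p u) ` P)))"
  unfolding worst_case_revenue_def
  by (intro INF_mono) (auto intro: expected_revenue_le_Max[OF assms])

text \<open>
  The type \<open>'j\<close> indexes the prices selected by Helly's theorem, possibly with repetitions, so that
  the separation takes place in the Euclidean space \<open>real ^ 'j\<close>.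
\<close>

lemma small_support_pricing_of_lower_bound:
  fixes P :: "'p set" and U :: "'a::euclidean_space set"
  assumes "finite P" and "U \<noteq> {}" and "convex U"
    and R: "\<And>p. p \<in> P \<Longrightarrow> convex_on U (R p)"
    and dim: "CARD('j::finite) = DIM('a) + 1"
    and v: "\<And>u. u \<in> U \<Longrightarrow> \<exists>p\<in>P. v \<le> R p u"
  obtains \<pi> where "\<pi> \<in> price_simplex P" "card {p \<in> P. 0 < \<pi> p} \<le> DIM('a) + 1"
    "\<And>u. u \<in> U \<Longrightarrow> v \<le> expected_revenue P R \<pi> u"
proof -
  have "P \<noteq> {}"
    using v \<open>U \<noteq> {}\<close> by blast
  then have "\<Inter>((\<lambda>p. {u \<in> U. R p u < v}) ` P) = {}"
    using v by (fastforce simp: not_less)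
  then obtain S where S: "S \<subseteq> P" "card S \<le> DIM('a) + 1"
    "\<Inter>((\<lambda>p. {u \<in> U. R p u < v}) ` S) = {}"
    using helly_indexed[of P "\<lambda>p. {u \<in> U. R p u < v}"] \<open>finite P\<close>
      convex_on_imp_convex_strict_sublevel[OF R] by auto
  \<comment> \<open>An intersection over no index would be \<open>UNIV\<close>, hence not
    empty.\<close>
  have "S \<noteq> {}" "finite S"
    using S \<open>finite P\<close> finite_subset by auto
  then obtain h :: "'j \<Rightarrow> 'p" where h: "range h = S"
    using S dim by (metis ex_fun_range_eq)
  have hP: "h j \<in> P" for j
    using h S(1) by blast
  have "\<exists>j. v \<le> R (h j) u" if "u \<in> U" for u
  proof -
    have "\<exists>p\<in>S. v \<le> R p u"
      using S(3) that by (auto simp: set_eq_iff not_less)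
    then show ?thesis
      using h by blast
  qed
  then obtain a :: "'j \<Rightarrow> real" where a: "\<And>j. 0 \<le> a j" "(\<Sum>j\<in>UNIV. a j) = 1"
    "\<And>u. u \<in> U \<Longrightarrow> v \<le> (\<Sum>j\<in>UNIV. a j * R (h j) u)"
    using convex_on_weights_of_alternative[of U "\<lambda>j. R (h j)" v] assms(2,3) R hP by blast
  \<comment> \<open>The image of the weights under \<open>h\<close>: indices that repeat a price add
    up their weights. \<open>restrict\<close> makes the function extensional, as
    \<open>price_simplex\<close> demands.\<close>
  define \<pi> where "\<pi> = restrict (\<lambda>p. \<Sum>j | h j = p. a j) P"
  \<comment> \<open>Change of variables along \<open>h\<close>, used with \<open>g\<close>
    constantly 1 for the total mass and with the revenues at \<open>u\<close> for the lower
    bound.\<close>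
  have push: "(\<Sum>p\<in>P. \<pi> p * g p) = (\<Sum>j\<in>UNIV. a j * g (h j))" for g
  proof -
    have "(\<Sum>p\<in>P. \<pi> p * g p) = (\<Sum>p\<in>P. \<Sum>j | h j = p. a j * g (h j))"
      by (intro sum.cong) (auto simp: \<pi>_def sum_distrib_right)
    also have "\<dots> = (\<Sum>j\<in>UNIV. a j * g (h j))"
      using sum.group[of UNIV P h "\<lambda>j. a j * g (h j)"] \<open>finite P\<close> hP by auto
    finally show ?thesis .
  qed
  show ?thesis
  proof (rule that)
    show "\<pi> \<in> price_simplex P"
      using push[of "\<lambda>_. 1"] a by (auto simp: price_simplex_def \<pi>_def sum_nonneg)
    have "{p \<in> P. 0 < \<pi> p} \<subseteq> S"
    proof
      fix p assume "p \<in> {p \<in> P. 0 < \<pi> p}"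
      then have "{j. h j = p} \<noteq> {}"
        by (auto simp: \<pi>_def simp del: Collect_empty_eq)
      then show "p \<in> S"
        using h by blast
    qed
    then show "card {p \<in> P. 0 < \<pi> p} \<le> DIM('a) + 1"
      using S(2) card_mono[OF \<open>finite S\<close>] le_trans by blast
    show "v \<le> expected_revenue P R \<pi> u" if "u \<in> U" for u
      using a(3)[OF that] by (simp add: expected_revenue_def push)
  qed
qed

lemma point_pricing_in_price_simplex:
  assumes "finite P" "p \<in> P"
  shows "restrict (indicat_real {p}) P \<in> price_simplex P"
  using assms by (simp add: price_simplex_def indicator_def)

theorem theorem4:
  fixes P :: "(real ^ 'i) set"
    and U :: "(real ^ 'm) set"
    and R :: "real ^ 'i \<Rightarrow> real ^ 'm \<Rightarrow> real"
  assumes "finite P" and "P \<noteq> {}"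
    and "\<And>p i. p \<in> P \<Longrightarrow> 0 \<le> p $ i"
    and "U \<noteq> {}" and "convex U" and "compact U"
    and "\<And>p. p \<in> P \<Longrightarrow> convex_on U (R p)"
  shows "\<exists>\<pi>. optimal_randomized_pricing P U R \<pi> \<and> card {p \<in> P. 0 < \<pi> p} \<le> CARD('m) + 1"
proof -
  define V where "V = (INF u\<in>U. ereal (Max ((\<lambda>p. R p u) ` P)))"
  have optimal: "optimal_randomized_pricing P U R \<pi>"
    if "\<pi> \<in> price_simplex P" "V \<le> worst_case_revenue P U R \<pi>" for \<pi>
    using that worst_case_revenue_le_minimax[OF assms(1,2), of _ U R] order_trans
    unfolding optimal_randomized_pricing_def V_def by blast
  have V_le: "V \<le> ereal (Max ((\<lambda>p. R p u) ` P))" if "u \<in> U" for u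
    unfolding V_def using that by (rule INF_lower)
  show ?thesis
  proof (cases V)
    case (real v)
    have "\<exists>p\<in>P. v \<le> R p u" if "u \<in> U" for u
      using V_le[OF that] assms(1,2) by (simp add: real Max_ge_iff)
    then obtain \<pi> where \<pi>: "\<pi> \<in> price_simplex P" "card {p \<in> P. 0 < \<pi> p} \<le> CARD('m) + 1"
      "\<And>u. u \<in> U \<Longrightarrow> v \<le> expected_revenue P R \<pi> u"
      \<comment> \<open>\<open>'m option\<close> has \<open>CARD('m) + 1\<close> elements, one more
        than the dimension of \<open>real ^ 'm\<close>.\<close>
      using small_support_pricing_of_lower_bound[where 'j = "'m option", of P U R v] assms
      by auto
    have "V \<le> worst_case_revenue P U R \<pi>"
      unfolding worst_case_revenue_def real using \<pi>(3) by (intro INF_greatest) simp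
    then show ?thesis
      using optimal \<pi> by blast
  next
    case PInf
    then show ?thesis
      using V_le assms(4) by auto
  next
    \<comment> \<open>The upper bound is minus infinity, so every pricing is optimal, and a point
      mass has a support of size one.\<close>
    case MInf
    obtain p where p: "p \<in> P"
      using assms(2) by blast
    have "card {q \<in> P. 0 < restrict (indicat_real {p}) P q} \<le> card {p}"
      by (intro card_mono) (auto simp: indicator_def split: if_splits)
    then show ?thesis
      using optimal[OF point_pricing_in_price_simplex[OF assms(1) p]] MInf
      by (intro exI[of _ "restrict (indicat_real {p}) P"]) simp
  qed
qed

end
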